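(* Let $G,g,T>0$, $g<G$, and $\alpha\in[0,1]$. Define \[ S_{\mathrm{spec}}(\alpha)=\frac{G+T}{\alpha\,\max\{G,\,g+T\}+(1-\alpha)(G+T)}. \] Then: (1) $S_{\mathrm{spec}}(\alpha)$ is strictly increasing in $\alpha$, hence $S_{\mathrm{spec}}(\alpha)>1$ for all $\alpha>0$. (2) The maximum over $\alpha\in[0,1]$ is attained at $\alpha=1$ and equals \[ S_{\max}=\frac{G+T}{\max\{G,\,g+T\}}. \] (3) Moreover, \[ S_{\max}\le \frac{2(G+T)}{G+g+T}=2-\frac{2g}{G+g+T}<2. \] In particular, the supremum $2$ is approached only in the limit $g\to 0^+$.
   Context: All quantities are real numbers. Interpretation (not needed for the mathematical statement): $G$ is the average generation time of the main language model, $g$ the average generation time of a speculative model, $T$ the average tool call time, and $\alpha$ the acceptance rate of the speculative model. The time to process $N$ requests is $N(G+T)$ without speculation and $\alpha N\max\{G,g+T\}+(1-\alpha)N(G+T)$ with client-side speculation, and $S_{\mathrm{spec}}(\alpha)$ is the ratio of the former to the latter, i.e. the speedup.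
   Formalization: "Approached only as g→0+" fails if G,T vary without bound (G=n, g=1, T=n−1 gives S_max=2−1/n); it is proved as g/G→0+ in general and as g→0+ when G stays bounded, in particular for fixed G,T. *)

theory Defs
  imports Complex_Main
begin

definition admissible :: "real \<Rightarrow> real \<Rightarrow> real \<Rightarrow> bool" where
  "admissible G g T \<longleftrightarrow> 0 < G \<and> 0 < g \<and> 0 < T \<and> g < G"

definition S_spec :: "real \<Rightarrow> real \<Rightarrow> real \<Rightarrow> real \<Rightarrow> real" where
  "S_spec G g T \<alpha> = (G + T) / (\<alpha> * max G (g + T) + (1 - \<alpha>) * (G + T))"

(* S_max is invariant under rescaling (G, g, T) by a common positive factor, so it can tend
   to 2 with g constant if G and T are unbounded: S_max n 1 (n - 1) = 2 - 1/n.  Hence, when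
   G and T vary, "only as g tends to 0" has to be read as g relative to G, or as g itself
   with G bounded. *)
definition S_max :: "real \<Rightarrow> real \<Rightarrow> real \<Rightarrow> real" where
  "S_max G g T = (G + T) / max G (g + T)"

end

theory Submission
  imports Defs
begin

text \<open>The denominator of \<open>S_spec\<close> is the convex combination of \<open>G + T\<close> and the smaller
  \<open>max G (g + T)\<close>, so it decreases in \<open>\<alpha>\<close>. For the limiting behaviour the key estimate is
  \<open>S_max G g T \<le> 2 - g / G\<close> (with equality at \<open>T = G - g\<close>): a value of \<open>S_max\<close> near 2
  forces \<open>g / G\<close> to be near 0.\<close>

lemma max_less_sum:
  assumes "admissible G g T"
  shows "max G (g + T) < G + T"
  using assms by (auto simp: admissible_def)

lemma S_spec_denominator_pos:
  assumes "admissible G g T" "0 \<le> \<alpha>" "\<alpha> \<le> 1"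
  shows "0 < \<alpha> * max G (g + T) + (1 - \<alpha>) * (G + T)"
proof -
  have "0 < max G (g + T)"
    using assms(1) by (auto simp: admissible_def)
  \<comment> \<open>Writing the maximum as a convex combination of itself reduces the bound to one
    on the second term.\<close>
  also have "\<dots> = \<alpha> * max G (g + T) + (1 - \<alpha>) * max G (g + T)"
    by (simp add: algebra_simps)
  also have "\<dots> \<le> \<alpha> * max G (g + T) + (1 - \<alpha>) * (G + T)"
    using max_less_sum[OF assms(1)] assms by (intro add_left_mono mult_left_mono) auto
  finally show ?thesis .
qed

lemma strict_mono_on_S_spec:
  assumes "admissible G g T"
  shows "strict_mono_on {0..1} (S_spec G g T)"
proof (rule strict_mono_onI)
  fix a b :: real
  assume a: "a \<in> {0..1}" and b: "b \<in> {0..1}" and "a < b"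
  \<comment> \<open>The denominator equals \<open>G + T\<close> minus this product, the time saved
    by speculation.\<close>
  then have "a * (G + T - max G (g + T)) < b * (G + T - max G (g + T))"
    using max_less_sum[OF assms] by (intro mult_strict_right_mono) auto
  then have "b * max G (g + T) + (1 - b) * (G + T) < a * max G (g + T) + (1 - a) * (G + T)"
    by (simp add: algebra_simps)
  moreover have "0 < G + T"
    using assms by (auto simp: admissible_def)
  ultimately show "S_spec G g T a < S_spec G g T b"
    using S_spec_denominator_pos[OF assms, of b] b
    unfolding S_spec_def by (intro divide_strict_left_mono) auto
qed

lemma S_spec_0:
  assumes "admissible G g T"
  shows "S_spec G g T 0 = 1"
  using assms by (simp add: S_spec_def admissible_def)

lemma S_spec_1: "S_spec G g T 1 = S_max G g T"
  by (simp add: S_spec_def S_max_def)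

text \<open>A maximum is at least the arithmetic mean of its arguments, here \<open>G\<close> and
  \<open>g + T\<close>.\<close>

lemma S_max_le_mean:
  assumes "admissible G g T"
  shows "S_max G g T \<le> 2 * (G + T) / (G + g + T)"
proof -
  have "S_max G g T \<le> (G + T) / ((G + g + T) / 2)"
    unfolding S_max_def using assms
    by (intro divide_left_mono) (auto simp: admissible_def max_def)
  then show ?thesis
    by (simp add: mult.commute)
qed

text \<open>For fixed \<open>G\<close> and \<open>g\<close>, \<open>S_max\<close> increases in
  \<open>T\<close> up to \<open>T = G - g\<close> and decreases afterwards, so the two cases meet at
  the peak. The mean bound would only control \<open>g / (G + g + T)\<close>, which can be small
  merely because \<open>T\<close> is large.\<close>

lemma S_max_le_ratio:
  assumes "admissible G g T"
  shows "S_max G g T \<le> 2 - g / G"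
proof (cases "g + T \<le> G")
  case True
  then have "S_max G g T = (G + T) / G"
    by (simp add: S_max_def)
  also have "\<dots> \<le> (2 * G - g) / G"
    using True assms by (intro divide_right_mono) (auto simp: admissible_def)
  also have "\<dots> = 2 - g / G"
    using assms by (simp add: admissible_def diff_divide_distrib)
  finally show ?thesis .
next
  case False
  then have "S_max G g T = 1 + (G - g) / (g + T)"
    using assms by (simp add: S_max_def admissible_def field_simps)
  also have "\<dots> \<le> 1 + (G - g) / G"
    using False assms by (intro add_left_mono divide_left_mono) (auto simp: admissible_def)
  also have "\<dots> = 2 - g / G"
    using assms by (simp add: admissible_def diff_divide_distrib)
  finally show ?thesis .
qed

text \<open>The choice \<open>T = G\<close> does not depend on \<open>g\<close> and is the limit of
  the optimal \<open>T = G - g\<close>; continuity at \<open>g = 0\<close> then gives the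
  value.\<close>

lemma tendsto_S_max_diagonal:
  assumes "0 < G"
  shows "((\<lambda>g. S_max G g G) \<longlongrightarrow> 2) (at_right 0)"
proof -
  have "((\<lambda>g. (G + G) / max G (g + G)) \<longlongrightarrow> (G + G) / max G (0 + G)) (at_right 0)"
    using assms by (intro tendsto_intros) auto
  then show ?thesis
    using assms by (simp add: S_max_def)
qed

lemma Sup_S_max: "Sup {S_max G g T | G g T. admissible G g T} = 2" (is "Sup ?A = 2")
proof (rule cSup_eq_non_empty)
  have "admissible 2 1 1"
    by (simp add: admissible_def)
  then show "?A \<noteq> {}"
    by blast
next
  fix x assume "x \<in> ?A"
  then obtain G g T where x: "x = S_max G g T" and adm: "admissible G g T"
    by blast
  have "0 < g / G"
    using adm by (simp add: admissible_def)
  then show "x \<le> 2"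
    using S_max_le_ratio[OF adm] x by linarith
next
  fix y assume ub: "\<And>x. x \<in> ?A \<Longrightarrow> x \<le> y"
  \<comment> \<open>Every upper bound dominates the diagonal family with \<open>G = T = 1\<close>,
    admissible exactly for these \<open>g\<close>, and hence its limit 2.\<close>
  have "\<forall>\<^sub>F g in at_right 0. g \<in> {0<..<1 :: real}"
    by (intro eventually_at_right_real) simp
  then have "\<forall>\<^sub>F g in at_right 0. S_max 1 g 1 \<le> y"
  proof eventually_elim
    case (elim g)
    then have "admissible 1 g 1"
      by (simp add: admissible_def)
    then show ?case
      using ub by blast
  qed
  then show "2 \<le> y"
    by (intro tendsto_upperbound[OF tendsto_S_max_diagonal[of 1]]) auto
qed

text \<open>The ratio is squeezed between 0 and \<open>2 - S_max\<close>; its positivity makes the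
  limit one-sided.\<close>

lemma filterlim_ratio_at_right_0:
  assumes adm: "\<And>n. admissible (G n) (g n) (T n)"
    and lim: "(\<lambda>n. S_max (G n) (g n) (T n)) \<longlonglongrightarrow> 2"
  shows "filterlim (\<lambda>n. g n / G n) (at_right 0) sequentially"
proof -
  have pos: "0 < g n / G n" for n
    using adm[of n] by (simp add: admissible_def)
  have "(\<lambda>n. 2 - S_max (G n) (g n) (T n)) \<longlonglongrightarrow> 2 - 2"
    by (intro tendsto_intros lim)
  then have upper: "(\<lambda>n. 2 - S_max (G n) (g n) (T n)) \<longlonglongrightarrow> 0"
    by simp
  have "g n / G n \<le> 2 - S_max (G n) (g n) (T n)" for n
    using S_max_le_ratio[OF adm[of n]] by linarith
  then have "(\<lambda>n. g n / G n) \<longlonglongrightarrow> 0"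
    using pos by (intro tendsto_sandwich[OF _ _ tendsto_const upper] always_eventually)
      (auto intro: less_imp_le)
  then show ?thesis
    using pos by (simp add: tendsto_imp_filterlim_at_right)
qed

text \<open>A null sequence times a bounded one is null, applied to
  \<open>g = (g / G) * G\<close>.\<close>

lemma filterlim_at_right_0_of_ratio:
  fixes G g :: "nat \<Rightarrow> real"
  assumes pos: "\<And>n. 0 < G n" "\<And>n. 0 < g n"
    and lim: "filterlim (\<lambda>n. g n / G n) (at_right 0) sequentially"
    and "Bseq G"
  shows "filterlim g (at_right 0) sequentially"
proof -
  have "Zfun (\<lambda>n. g n / G n) sequentially"
    using lim by (simp add: filterlim_at tendsto_Zfun_iff)
  then have "Zfun (\<lambda>n. g n / G n * G n) sequentially"
    using bounded_bilinear.Zfun_prod_Bfun[OF bounded_bilinear_mult _ \<open>Bseq G\<close>] by blast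
  moreover have "g n / G n * G n = g n" for n
    using pos(1)[of n] by simp
  ultimately have "g \<longlonglongrightarrow> 0"
    by (simp add: tendsto_Zfun_iff)
  then show ?thesis
    using pos(2) by (simp add: tendsto_imp_filterlim_at_right)
qed

text \<open>The last group makes the closing remark on the supremum precise: 2 is the least upper
  bound over all parameters, shrinking \<open>g\<close> approaches it, and sequences with all three
  parameters varying express that nothing else does.\<close>

theorem lemma1:
  fixes G g T :: real
  assumes "admissible G g T"
  shows "(strict_mono_on {0..1} (S_spec G g T) \<and>
          (\<forall>\<alpha>\<in>{0..1}. \<alpha> > 0 \<longrightarrow> S_spec G g T \<alpha> > 1)) \<and>
         ((\<forall>\<alpha>\<in>{0..1}. S_spec G g T \<alpha> \<le> S_spec G g T 1) \<and>
          S_spec G g T 1 = S_max G g T) \<and>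
         (S_max G g T \<le> 2 * (G + T) / (G + g + T) \<and>
          2 * (G + T) / (G + g + T) = 2 - 2 * g / (G + g + T) \<and>
          2 - 2 * g / (G + g + T) < 2) \<and>
         (Sup {S_max G' g' T' | G' g' T'. admissible G' g' T'} = 2 \<and>
          ((\<lambda>g'. S_max G g' G) \<longlongrightarrow> 2) (at_right 0) \<and>
          (\<forall>Gs gs Ts :: nat \<Rightarrow> real.
             (\<forall>n. admissible (Gs n) (gs n) (Ts n)) \<and>
             (\<lambda>n. S_max (Gs n) (gs n) (Ts n)) \<longlonglongrightarrow> 2 \<longrightarrow>
               filterlim (\<lambda>n. gs n / Gs n) (at_right 0) sequentially \<and>
               (Bseq Gs \<longrightarrow> filterlim gs (at_right 0) sequentially)))"
proof (intro conjI ballI allI impI)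
  have pos: "0 < G" "0 < g" "0 < T"
    using assms by (auto simp: admissible_def)
  note mono = strict_mono_on_S_spec[OF assms]
  show "strict_mono_on {0..1} (S_spec G g T)"
    by (fact mono)
  show "S_spec G g T \<alpha> > 1" if "\<alpha> \<in> {0..1}" "\<alpha> > 0" for \<alpha>
    \<comment> \<open>The bound 1 is the value at \<open>0\<close>, where no speculation
      succeeds.\<close>
    using strict_mono_onD[OF mono, of 0 \<alpha>] that S_spec_0[OF assms] by simp
  show "S_spec G g T \<alpha> \<le> S_spec G g T 1" if "\<alpha> \<in> {0..1}" for \<alpha>
    using strict_mono_onD[OF mono, of \<alpha> 1] that by (cases "\<alpha> = 1") auto
  show "S_spec G g T 1 = S_max G g T"
    by (fact S_spec_1)
  show "S_max G g T \<le> 2 * (G + T) / (G + g + T)"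
    by (fact S_max_le_mean[OF assms])
  show "2 * (G + T) / (G + g + T) = 2 - 2 * g / (G + g + T)"
    using pos by (simp add: field_simps)
  show "2 - 2 * g / (G + g + T) < 2"
    using pos by simp
  show "Sup {S_max G' g' T' | G' g' T'. admissible G' g' T'} = 2"
    by (fact Sup_S_max)
  show "((\<lambda>g'. S_max G g' G) \<longlongrightarrow> 2) (at_right 0)"
    by (fact tendsto_S_max_diagonal[OF pos(1)])
next
  fix Gs gs Ts :: "nat \<Rightarrow> real"
  assume "(\<forall>n. admissible (Gs n) (gs n) (Ts n)) \<and>
          (\<lambda>n. S_max (Gs n) (gs n) (Ts n)) \<longlonglongrightarrow> 2"
  then show "filterlim (\<lambda>n. gs n / Gs n) (at_right 0) sequentially"
    by (intro filterlim_ratio_at_right_0[where T = Ts]) auto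
next
  fix Gs gs Ts :: "nat \<Rightarrow> real"
  assume *: "(\<forall>n. admissible (Gs n) (gs n) (Ts n)) \<and>
             (\<lambda>n. S_max (Gs n) (gs n) (Ts n)) \<longlonglongrightarrow> 2"
    and "Bseq Gs"
  show "filterlim gs (at_right 0) sequentially"
  proof (rule filterlim_at_right_0_of_ratio)
    show "filterlim (\<lambda>n. gs n / Gs n) (at_right 0) sequentially"
      using * by (intro filterlim_ratio_at_right_0[where T = Ts]) auto
  qed (use * \<open>Bseq Gs\<close> in \<open>auto simp: admissible_def\<close>)
qed

end
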